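(* The triplet $(\ell_\infty, B_{c_0}, \mathcal{CB}(\ell_\infty))$ has property-$(P_1)$, and the map $\mathrm{cent}_{B_{c_0}}(\cdot)$ is uniformly Hausdorff metric continuous on $\mathcal{CB}(\ell_\infty)$.
   Context: All Banach spaces are real; $c_0\subseteq\ell_\infty$ carry the supremum norm. For a Banach space $E$, $B_E$ is its closed unit ball and $\mathcal{CB}(E)$ is the class of non-empty closed bounded subsets of $E$, with Hausdorff metric $d_H(A,B)=\inf\{t>0: A\subseteq B+tB_E,\ B\subseteq A+tB_E\}$. For $v\in E$ and a non-empty bounded set $F\subseteq E$, $r(v,F)=\sup_{z\in F}\|v-z\|$. For a non-empty closed convex $V\subseteq E$: $\mathrm{rad}_V(F)=\inf_{v\in V}r(v,F)$, $\mathrm{cent}_V(F)=\{v\in V: r(v,F)=\mathrm{rad}_V(F)\}$, and for $\delta>0$, $\mathrm{cent}_V(F,\delta)=\{v\in V: r(v,F)\le \mathrm{rad}_V(F)+\delta\}$. For $\mathscr F\subseteq\mathcal{CB}(E)$, the pair $(V,\mathscr F)$ has the restricted center property (r.c.p.) if $\mathrm{cent}_V(F)\ne\emptyset$ for every $F\in\mathscr F$. The triplet $(E,V,\mathscr F)$ has property-$(P_1)$ if $(V,\mathscr F)$ has r.c.p. and for every $\varepsilon>0$ and $F\in\mathscr F$ there is $\delta>0$ with $\mathrm{cent}_V(F,\delta)\subseteq\mathrm{cent}_V(F)+\varepsilon B_E$. The map $\mathrm{cent}_V(\cdot)$ is uniformly Hausdorff metric continuous on $\mathcal{CB}(E)$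 if it is uniformly continuous as a single-valued map from $(\mathcal{CB}(E),d_H)$ to $(\mathcal{CB}(E),d_H)$. *)

theory Defs
  imports "HOL-Analysis.Analysis"
begin

(* nat carries the discrete topology, so every sequence is continuous and
   nat \<Rightarrow>\<^sub>C real is the space of all bounded real sequences with the supremum norm. *)
type_synonym linfty = "nat \<Rightarrow>\<^sub>C real"

definition c0 :: "linfty set" where
  "c0 = {x. apply_bcontfun x \<longlonglongrightarrow> 0}"

definition ball_c0 :: "linfty set" where
  "ball_c0 = c0 \<inter> cball 0 1"

definition CB :: "'a::real_normed_vector set set" where
  "CB = {A. A \<noteq> {} \<and> closed A \<and> bounded A}"

definition enlarge :: "'a::real_normed_vector set \<Rightarrow> real \<Rightarrow> 'a set" where
  "enlarge A t = {a + t *\<^sub>R b | a b. a \<in> A \<and> b \<in> cball 0 1}"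

(* The real-valued Sup and Inf below are only meaningful for non-empty bounded sets,
   which is the only case in which hausdorff_dist, rad_at and rad are used. *)
definition hausdorff_dist :: "'a::real_normed_vector set \<Rightarrow> 'a set \<Rightarrow> real" where
  "hausdorff_dist A B = Inf {t. t > 0 \<and> A \<subseteq> enlarge B t \<and> B \<subseteq> enlarge A t}"

definition rad_at :: "'a::real_normed_vector \<Rightarrow> 'a set \<Rightarrow> real" where
  "rad_at v F = (SUP z\<in>F. norm (v - z))"

definition rad :: "'a::real_normed_vector set \<Rightarrow> 'a set \<Rightarrow> real" where
  "rad V F = (INF v\<in>V. rad_at v F)"

definition cent :: "'a::real_normed_vector set \<Rightarrow> 'a set \<Rightarrow> 'a set" where
  "cent V F = {v \<in> V. rad_at v F = rad V F}"

definition near_cent :: "'a::real_normed_vector set \<Rightarrow> 'a set \<Rightarrow> real \<Rightarrow> 'a set" where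
  "near_cent V F \<delta> = {v \<in> V. rad_at v F \<le> rad V F + \<delta>}"

definition restricted_center_property :: "'a::real_normed_vector set \<Rightarrow> 'a set set \<Rightarrow> bool" where
  "restricted_center_property V \<F> \<longleftrightarrow> (\<forall>F\<in>\<F>. cent V F \<noteq> {})"

(* The ambient space E of the triplet (E, V, \<F>) is the type 'a. *)
definition property_P1 :: "'a::real_normed_vector set \<Rightarrow> 'a set set \<Rightarrow> bool" where
  "property_P1 V \<F> \<longleftrightarrow>
     restricted_center_property V \<F> \<and>
     (\<forall>\<epsilon>>0. \<forall>F\<in>\<F>. \<exists>\<delta>>0. near_cent V F \<delta> \<subseteq> enlarge (cent V F) \<epsilon>)"

(* Uniform continuity of \<Phi> as a map from (CB, hausdorff_dist) to itself; the first
   conjunct says that \<Phi> really takes its values in CB. *)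
definition uniformly_hausdorff_continuous :: "('a::real_normed_vector set \<Rightarrow> 'a set) \<Rightarrow> bool" where
  "uniformly_hausdorff_continuous \<Phi> \<longleftrightarrow>
     (\<forall>F\<in>CB. \<Phi> F \<in> CB) \<and>
     (\<forall>\<epsilon>>0. \<exists>\<delta>>0. \<forall>F\<in>CB. \<forall>G\<in>CB.
        hausdorff_dist F G < \<delta> \<longrightarrow> hausdorff_dist (\<Phi> F) (\<Phi> G) < \<epsilon>)"

lemma norm_linfty: "norm (x :: linfty) = (SUP n. \<bar>apply_bcontfun x n\<bar>)"
  by (simp add: norm_bcontfun_def dist_bcontfun_def)

lemma bounded_sequence_linfty:
  assumes "bounded (range (f :: nat \<Rightarrow> real))"
  shows "\<exists>x :: linfty. apply_bcontfun x = f"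
proof -
  have "f \<in> bcontfun" using assms by (simp add: bcontfun_def)
  then show ?thesis by (intro exI[of _ "Bcontfun f"]) (rule Bcontfun_inverse)
qed

(* The library's complete_space instance for \<Rightarrow>\<^sub>C wants a metric_space as domain,
   which nat is not; hence the class real_normed_vector above and this lemma. *)
lemma complete_linfty: "complete (UNIV :: linfty set)"
proof (rule completeI)
  fix f :: "nat \<Rightarrow> linfty"
  assume "Cauchy f"
  then obtain g where "uniform_limit UNIV (\<lambda>n. apply_bcontfun (f n)) g sequentially"
    using uniformly_convergent_eq_cauchy[of "\<lambda>_. True" "\<lambda>n. apply_bcontfun (f n)"]
    unfolding Cauchy_def uniform_limit_sequentially_iff
    by (metis dist_fun_lt_imp_dist_val_lt)
  from uniform_limit_bcontfunE[OF this sequentially_bot]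
  obtain l :: linfty where "f \<longlonglongrightarrow> l" by metis
  then show "\<exists>l\<in>UNIV. f \<longlonglongrightarrow> l" by blast
qed

lemma closed_c0: "closed c0"
  unfolding closed_sequential_limits
proof (intro allI impI, elim conjE)
  fix X :: "nat \<Rightarrow> linfty" and x
  assume X: "\<forall>n. X n \<in> c0" and lim: "X \<longlonglongrightarrow> x"
  have "apply_bcontfun x \<longlonglongrightarrow> 0"
  proof (rule tendstoI)
    fix e :: real assume e: "e > 0"
    from lim e have "\<forall>\<^sub>F n in sequentially. dist (X n) x < e / 2"
      by (intro tendstoD) auto
    then obtain n where n: "dist (X n) x < e / 2"
      by (auto simp: eventually_sequentially)
    from X have "apply_bcontfun (X n) \<longlonglongrightarrow> 0" by (simp add: c0_def)
    then have "\<forall>\<^sub>F k in sequentially. dist (apply_bcontfun (X n) k) 0 < e / 2"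
      using e by (intro tendstoD) auto
    then show "\<forall>\<^sub>F k in sequentially. dist (apply_bcontfun x k) 0 < e"
    proof eventually_elim
      case (elim k)
      have "dist (apply_bcontfun (X n) k) (apply_bcontfun x k) < e / 2"
        using n by (rule dist_fun_lt_imp_dist_val_lt)
      with elim show ?case unfolding dist_real_def by linarith
    qed
  qed
  then show "x \<in> c0" by (simp add: c0_def)
qed

lemma ball_c0_nonempty_closed_convex: "ball_c0 \<noteq> {}" "closed ball_c0" "convex ball_c0"
proof -
  have "0 \<in> ball_c0" by (simp add: ball_c0_def c0_def)
  then show "ball_c0 \<noteq> {}" by blast
  show "closed ball_c0" unfolding ball_c0_def by (intro closed_Int closed_c0 closed_cball)
  have "convex c0"
  proof (rule convexI)
    fix x y :: linfty and u v :: real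
    assume "x \<in> c0" "y \<in> c0"
    then have "(\<lambda>n. u * x n + v * y n) \<longlonglongrightarrow> u * 0 + v * 0"
      unfolding c0_def by (intro tendsto_intros) auto
    then show "u *\<^sub>R x + v *\<^sub>R y \<in> c0"
      by (simp add: c0_def plus_bcontfun.rep_eq scaleR_bcontfun.rep_eq)
  qed
  then show "convex ball_c0" unfolding ball_c0_def by (intro convex_Int convex_cball)
qed

end

theory Submission
  imports Defs
begin

text \<open>
  For bounded \<open>F \<subseteq> \<ell>\<^sub>\<infinity>\<close> put \<open>s n = sup {z n | z \<in> F}\<close> and \<open>i n = inf {z n | z \<in> F}\<close>. Then
  \<open>r(v, F) \<le> r\<close> says that \<open>v n\<close> lies in \<open>[s n - r, i n + r]\<close> for all \<open>n\<close>. If \<open>R\<close> is the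
  restricted radius of \<open>F\<close> and \<open>v \<in> B\<^bsub>c\<^sub>0\<^esub>\<close> has \<open>r(v, F) \<le> R + \<delta>\<close>, then moving each \<open>v n\<close>
  to the nearest point of \<open>[s n - R, i n + R]\<close> costs at most \<open>\<delta>\<close>. The result is again in
  \<open>B\<^bsub>c\<^sub>0\<^esub>\<close>, as elements of \<open>B\<^bsub>c\<^sub>0\<^esub>\<close> with radius arbitrarily close to \<open>R\<close> force
  \<open>s n - R \<le> 1\<close>, \<open>limsup (s n - R) \<le> 0\<close> and the symmetric bounds for \<open>i\<close>. So
  \<open>cent(F, \<delta>) \<subseteq> cent(F) + \<delta>B\<close> with a rate independent of \<open>F\<close>, whereas both \<open>r(v, \<cdot>)\<close> and the
  radius are 1-Lipschitz for the Hausdorff distance; hence the center map is 2-Lipschitz.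
\<close>

section \<open>Enlargements and the Hausdorff distance\<close>

lemma mem_enlargeI:
  assumes "a \<in> A" "norm (x - a) \<le> t" "t > 0"
  shows "x \<in> enlarge A t"
proof -
  have "x = a + t *\<^sub>R ((1 / t) *\<^sub>R (x - a))" using assms by simp
  moreover have "(1 / t) *\<^sub>R (x - a) \<in> cball 0 1" using assms by simp
  ultimately show ?thesis unfolding enlarge_def using assms(1) by blast
qed

lemma mem_enlargeE:
  assumes "x \<in> enlarge A t" "t > 0"
  obtains a where "a \<in> A" "norm (x - a) \<le> t"
proof -
  from assms obtain a b where "x = a + t *\<^sub>R b" "a \<in> A" "norm b \<le> 1"
    unfolding enlarge_def by auto
  with assms(2) have "norm (x - a) \<le> t" by (simp add: mult_left_le)
  with \<open>a \<in> A\<close> show ?thesis by (rule that)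
qed

lemma hausdorff_dist_le:
  assumes "t > 0" "A \<subseteq> enlarge B t" "B \<subseteq> enlarge A t"
  shows "hausdorff_dist A B \<le> t"
  unfolding hausdorff_dist_def
  by (rule cInf_lower) (use assms in \<open>auto intro!: bdd_belowI[of _ 0]\<close>)

text \<open>Makes the set under the infimum in \<open>hausdorff_dist\<close> non-empty. Allowing
  every \<open>t' \<ge> t\<close> lets the thresholds for the two inclusions be merged by taking
  their maximum.\<close>

lemma subset_enlarge_of_bounded:
  assumes "bounded A" "B \<noteq> {}"
  obtains t where "t > 0" "\<And>t'. t' \<ge> t \<Longrightarrow> A \<subseteq> enlarge B t'"
proof -
  from assms obtain b where b: "b \<in> B" by blast
  from assms(1) obtain M where M: "\<And>a. a \<in> A \<Longrightarrow> norm a \<le> M"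
    unfolding bounded_iff by blast
  show ?thesis
  proof (rule that[of "max 1 (M + norm b)"])
    fix t' assume t': "t' \<ge> max 1 (M + norm b)"
    show "A \<subseteq> enlarge B t'"
    proof
      fix a assume "a \<in> A"
      with M[of a] t' norm_triangle_ineq4[of a b] show "a \<in> enlarge B t'"
        by (intro mem_enlargeI[OF b]) auto
    qed
  qed auto
qed

lemma hausdorff_dist_lessE:
  assumes "hausdorff_dist A B < d" "A \<in> CB" "B \<in> CB"
  obtains t where "0 < t" "t < d" "A \<subseteq> enlarge B t" "B \<subseteq> enlarge A t"
proof -
  obtain t1 where t1: "t1 > 0" "\<And>t. t \<ge> t1 \<Longrightarrow> A \<subseteq> enlarge B t"
    using subset_enlarge_of_bounded[of A B] assms unfolding CB_def by blast
  obtain t2 where t2: "t2 > 0" "\<And>t. t \<ge> t2 \<Longrightarrow> B \<subseteq> enlarge A t"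
    using subset_enlarge_of_bounded[of B A] assms unfolding CB_def by blast
  let ?S = "{t. t > 0 \<and> A \<subseteq> enlarge B t \<and> B \<subseteq> enlarge A t}"
  have "max t1 t2 \<in> ?S" using t1 t2 by simp
  then have "?S \<noteq> {}" by blast
  from cInf_lessD[OF this assms(1)[unfolded hausdorff_dist_def]] that show ?thesis by blast
qed

section \<open>Radii and centers in a normed space\<close>

lemma rad_at_le_iff:
  assumes "F \<in> CB"
  shows "rad_at v F \<le> r \<longleftrightarrow> (\<forall>z\<in>F. norm (v - z) \<le> r)"
proof -
  from assms obtain M where M: "\<And>z. z \<in> F \<Longrightarrow> norm z \<le> M"
    unfolding CB_def bounded_iff by blast
  have "norm (v - z) \<le> norm v + M" if "z \<in> F" for z
    using M[OF that] norm_triangle_ineq4[of v z] by linarith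
  then have "bdd_above ((\<lambda>z. norm (v - z)) ` F)" by (rule bdd_aboveI2)
  with assms show ?thesis unfolding rad_at_def CB_def by (simp add: cSUP_le_iff)
qed

lemma rad_at_nonneg:
  assumes "F \<in> CB"
  shows "0 \<le> rad_at v F"
proof -
  from assms obtain z where "z \<in> F" unfolding CB_def by blast
  with rad_at_le_iff[OF assms, of v "rad_at v F"] have "norm (v - z) \<le> rad_at v F" by blast
  with norm_ge_zero show ?thesis by (rule order_trans)
qed

lemma rad_le_rad_at:
  assumes "F \<in> CB" "v \<in> V"
  shows "rad V F \<le> rad_at v F"
  unfolding rad_def
  by (rule cINF_lower[OF bdd_belowI2[of V 0]]) (use rad_at_nonneg[OF assms(1)] assms(2) in auto)

text \<open>Since \<open>rad V F\<close> is a lower bound of the radii, the equation defining a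
  center reduces to an upper bound. This exhibits the center set as an intersection of
  \<open>V\<close> with closed balls.\<close>

lemma mem_cent_iff:
  assumes "F \<in> CB"
  shows "v \<in> cent V F \<longleftrightarrow> v \<in> V \<and> (\<forall>z\<in>F. norm (v - z) \<le> rad V F)"
  using rad_le_rad_at[OF assms, of v V] rad_at_le_iff[OF assms, of v "rad V F"]
  unfolding cent_def by auto

lemma rad_nearly_attained:
  assumes "V \<noteq> {}" "e > 0"
  obtains v where "v \<in> V" "rad_at v F < rad V F + e"
proof -
  have "Inf ((\<lambda>v. rad_at v F) ` V) < rad V F + e"
    unfolding rad_def using assms(2) by simp
  from cInf_lessD[OF _ this] assms(1) that show ?thesis by auto
qed

lemma rad_at_le_enlarge:
  assumes "F \<in> CB" "G \<in> CB" "t > 0" "G \<subseteq> enlarge F t"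
  shows "rad_at v G \<le> rad_at v F + t"
  unfolding rad_at_le_iff[OF assms(2)]
proof
  fix z assume "z \<in> G"
  with assms obtain a where a: "a \<in> F" "norm (z - a) \<le> t"
    by (meson subsetD mem_enlargeE)
  with rad_at_le_iff[OF assms(1), of v "rad_at v F"] have "norm (v - a) \<le> rad_at v F" by blast
  moreover have "norm (v - z) \<le> norm (v - a) + norm (z - a)"
    using norm_triangle_ineq4[of "v - a" "z - a"] by simp
  ultimately show "norm (v - z) \<le> rad_at v F + t" using a by linarith
qed

lemma rad_le_enlarge:
  assumes "F \<in> CB" "G \<in> CB" "t > 0" "G \<subseteq> enlarge F t" "V \<noteq> {}"
  shows "rad V G \<le> rad V F + t"
proof (rule field_le_epsilon)
  fix e :: real assume "e > 0"
  from rad_nearly_attained[OF assms(5) this]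
  obtain v where v: "v \<in> V" "rad_at v F < rad V F + e" by blast
  with rad_le_rad_at[OF assms(2) v(1)] rad_at_le_enlarge[OF assms(1-4), of v]
  show "rad V G \<le> rad V F + t + e" by linarith
qed

lemma cent_in_CB:
  assumes "F \<in> CB" "closed V" "cent V F \<noteq> {}"
  shows "cent V F \<in> CB"
proof -
  have eq: "cent V F = V \<inter> (\<Inter>z\<in>F. cball z (rad V F))"
    using mem_cent_iff[OF assms(1)] by (auto simp: dist_norm norm_minus_commute)
  from assms(1) obtain z where "z \<in> F" unfolding CB_def by blast
  with eq have "cent V F \<subseteq> cball z (rad V F)" by blast
  then have "bounded (cent V F)" by (rule bounded_subset[OF bounded_cball])
  moreover have "closed (cent V F)"
    unfolding eq using assms(2) by (intro closed_Int closed_INT ballI closed_cball)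
  ultimately show ?thesis using assms(3) unfolding CB_def by blast
qed

section \<open>Continuity of the center map from a uniform rate\<close>

text \<open>Passing from \<open>F\<close> to \<open>G\<close> costs \<open>t\<close> in the radius
  at \<open>v\<close> and another \<open>t\<close> in the restricted radius, so a center of
  \<open>F\<close> is a \<open>2 * t\<close>-near center of \<open>G\<close>.\<close>

lemma cent_subset_enlarge:
  assumes "F \<in> CB" "G \<in> CB" "t > 0" "F \<subseteq> enlarge G t" "G \<subseteq> enlarge F t"
    and "near_cent V G (2 * t) \<subseteq> enlarge (cent V G) (2 * t)"
  shows "cent V F \<subseteq> enlarge (cent V G) (2 * t)"
proof
  fix v assume "v \<in> cent V F"
  then have v: "v \<in> V" "rad_at v F = rad V F" unfolding cent_def by auto
  then have "V \<noteq> {}" by blast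
  from rad_at_le_enlarge[OF assms(1-3,5), of v] rad_le_enlarge[OF assms(2,1,3,4) this] v
  have "v \<in> near_cent V G (2 * t)" unfolding near_cent_def by simp
  with assms(6) show "v \<in> enlarge (cent V G) (2 * t)" by blast
qed

text \<open>As \<open>near\<close> holds with the same rate for all \<open>F\<close>, the preceding
  inclusion applies in both directions; its factor 2 explains the choice
  \<open>e / 2\<close>.\<close>

lemma uniformly_hausdorff_continuous_cent:
  assumes "closed V"
    and cent: "\<And>F. F \<in> CB \<Longrightarrow> cent V F \<noteq> {}"
    and near: "\<And>F d. F \<in> CB \<Longrightarrow> d > 0 \<Longrightarrow> near_cent V F d \<subseteq> enlarge (cent V F) d"
  shows "uniformly_hausdorff_continuous (cent V)"
proof -
  have "hausdorff_dist (cent V F) (cent V G) < e"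
    if e: "e > 0" and FG: "F \<in> CB" "G \<in> CB" and d: "hausdorff_dist F G < e / 2" for e F G
  proof -
    from hausdorff_dist_lessE[OF d FG] obtain t where t: "0 < t" "t < e / 2"
      and sub: "F \<subseteq> enlarge G t" "G \<subseteq> enlarge F t" by blast
    have "hausdorff_dist (cent V F) (cent V G) \<le> 2 * t"
      using cent_subset_enlarge[OF FG t(1) sub near] cent_subset_enlarge[OF FG(2,1) t(1) sub(2,1) near]
        FG t(1) by (intro hausdorff_dist_le) auto
    with t show ?thesis by linarith
  qed
  then show ?thesis
    unfolding uniformly_hausdorff_continuous_def
    using cent_in_CB[OF _ assms(1) cent] by (metis half_gt_zero)
qed

section \<open>Coordinatewise construction of centers in the ball of \<open>c0\<close>\<close>

lemma norm_diff_le_iff_linfty: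
  "norm (x - y :: linfty) \<le> r \<longleftrightarrow> (\<forall>n. \<bar>x n - y n\<bar> \<le> r)"
  unfolding dist_norm[symmetric] dist_real_def[symmetric]
  using dist_bound[of x y r] dist_bounded[of x _ y] by (blast intro: order_trans)

lemma mem_ball_c0_iff:
  "v \<in> ball_c0 \<longleftrightarrow> apply_bcontfun v \<longlonglongrightarrow> 0 \<and> (\<forall>n. \<bar>v n\<bar> \<le> 1)"
  using norm_diff_le_iff_linfty[of v 0 1] by (simp add: ball_c0_def c0_def)

text \<open>Serves both halves of property-\<open>(P_1)\<close>: it produces a center at all, and
  one within \<open>d\<close> of the given near center.\<close>

lemma center_near_near_center:
  fixes F :: "linfty set"
  assumes F: "F \<in> CB" and v: "v \<in> ball_c0" and rv: "rad_at v F \<le> rad ball_c0 F + d"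
    and d: "d \<ge> 0"
  obtains w where "w \<in> cent ball_c0 F" "norm (v - w) \<le> d"
proof -
  define R where "R = rad ball_c0 F"
  define s where "s n = (SUP z\<in>F. apply_bcontfun z n)" for n
  define i where "i n = (INF z\<in>F. apply_bcontfun z n)" for n
  from F obtain M where M: "\<And>z. z \<in> F \<Longrightarrow> norm z \<le> M" unfolding CB_def bounded_iff by blast
  have abs_M: "z n \<le> M" "- M \<le> z n" if "z \<in> F" for z n
    using M[OF that] norm_diff_le_iff_linfty[of z 0 M] by (simp_all add: abs_le_iff minus_le_iff)
  have ne: "F \<noteq> {}" using F unfolding CB_def by blast
  have s_ge: "z n \<le> s n" if "z \<in> F" for z n
    unfolding s_def by (rule cSUP_upper[OF that bdd_aboveI2[of _ _ M]]) (rule abs_M)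
  have i_le: "i n \<le> z n" if "z \<in> F" for z n
    unfolding i_def by (rule cINF_lower[OF bdd_belowI2[of _ "- M"] that]) (rule abs_M)
  have bounds: "s n - r \<le> u n \<and> u n \<le> i n + r" if "rad_at u F \<le> r" for u r n
  proof -
    have "\<bar>u n - z n\<bar> \<le> r" if "z \<in> F" for z
      using \<open>rad_at u F \<le> r\<close> that rad_at_le_iff[OF F] norm_diff_le_iff_linfty by blast
    then have *: "z n \<le> u n + r" "u n - r \<le> z n" if "z \<in> F" for z using that by force+
    have "s n \<le> u n + r" unfolding s_def by (rule cSUP_least[OF ne]) (rule *)
    moreover have "u n - r \<le> i n" unfolding i_def by (rule cINF_greatest[OF ne]) (rule *)
    ultimately show ?thesis by linarith
  qed
  \<comment> \<open>That \<open>R\<close> is attained is not yet known, hence the slack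
    \<open>e\<close>. In the coordinatewise bounds below it is removed by letting \<open>e\<close>
    tend to 0.\<close>
  have approx: "\<exists>u\<in>ball_c0. \<forall>n. s n - R \<le> u n + e \<and> u n \<le> i n + R + e" if e: "e > 0" for e
  proof -
    obtain u where u: "u \<in> ball_c0" "rad_at u F < R + e"
      using rad_nearly_attained[OF ball_c0_nonempty_closed_convex(1) e] unfolding R_def by blast
    have "s n - R \<le> u n + e \<and> u n \<le> i n + R + e" for n
      using bounds[of u "R + e" n] u by linarith
    with u show ?thesis by blast
  qed
  have s_le: "s n - R \<le> 1" for n
  proof (rule field_le_epsilon)
    fix e :: real assume "e > 0"
    with approx obtain u where u: "u \<in> ball_c0" "s n - R \<le> u n + e" by blast
    then have "\<bar>u n\<bar> \<le> 1" unfolding mem_ball_c0_iff by blast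
    with u show "s n - R \<le> 1 + e" by linarith
  qed
  have i_ge: "- 1 \<le> i n + R" for n
  proof (rule field_le_epsilon)
    fix e :: real assume "e > 0"
    with approx obtain u where u: "u \<in> ball_c0" "u n \<le> i n + R + e" by blast
    then have "\<bar>u n\<bar> \<le> 1" unfolding mem_ball_c0_iff by blast
    with u show "- 1 \<le> i n + R + e" by linarith
  qed
  have si: "s n - R \<le> i n + R" for n
  proof (rule field_le_epsilon)
    fix e :: real assume "e > 0"
    then have "e / 2 > 0" by simp
    from approx[OF this] obtain u where "s n - R \<le> u n + e / 2" "u n \<le> i n + R + e / 2" by blast
    then show "s n - R \<le> i n + R + e" by linarith
  qed
  \<comment> \<open>The witness \<open>u\<close> varies with \<open>e\<close>, so only one-sided
    asymptotic bounds result: limsup of \<open>s n - R\<close> at most 0, liminf of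
    \<open>i n + R\<close> at least 0.\<close>
  have ev: "\<forall>\<^sub>F n in sequentially. s n - R < e \<and> - e < i n + R" if e: "e > 0" for e
  proof -
    from e approx[of "e / 2"] obtain u where u: "u \<in> ball_c0"
      "\<And>n. s n - R \<le> u n + e / 2 \<and> u n \<le> i n + R + e / 2" by auto
    have "apply_bcontfun u \<longlonglongrightarrow> 0" using u mem_ball_c0_iff by blast
    then have "\<forall>\<^sub>F n in sequentially. dist (u n) 0 < e / 2" using e by (intro tendstoD) auto
    then show ?thesis
    proof eventually_elim
      case (elim n)
      with u(2)[of n] show ?case unfolding dist_real_def by linarith
    qed
  qed
  \<comment> \<open>The point of \<open>[s n - R, i n + R]\<close> nearest to \<open>v n\<close>;
    the interval is non-empty by \<open>si\<close>.\<close>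
  define f where "f n = max (s n - R) (min (v n) (i n + R))" for n
  have vb: "\<bar>v n\<bar> \<le> 1" for n using v mem_ball_c0_iff by blast
  have fb: "\<bar>f n\<bar> \<le> 1" for n using vb[of n] s_le[of n] i_ge[of n] unfolding f_def by linarith
  then have "bounded (range f)" unfolding bounded_iff by auto
  from bounded_sequence_linfty[OF this] obtain w :: linfty where w: "apply_bcontfun w = f" by blast
  have "f \<longlonglongrightarrow> 0"
  proof (rule tendstoI)
    fix e :: real assume e: "e > 0"
    have "apply_bcontfun v \<longlonglongrightarrow> 0" using v mem_ball_c0_iff by blast
    then have "\<forall>\<^sub>F n in sequentially. dist (v n) 0 < e" using e by (intro tendstoD) auto
    with ev[OF e] show "\<forall>\<^sub>F n in sequentially. dist (f n) 0 < e"
    proof eventually_elim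
      case (elim n)
      then show ?case unfolding f_def dist_real_def by linarith
    qed
  qed
  with fb w have "w \<in> ball_c0" unfolding mem_ball_c0_iff by simp
  moreover have "norm (w - z) \<le> R" if "z \<in> F" for z
    unfolding norm_diff_le_iff_linfty w
  proof
    fix n
    show "\<bar>f n - z n\<bar> \<le> R"
      using s_ge[OF that, of n] i_le[OF that, of n] si[of n] unfolding f_def by linarith
  qed
  ultimately have "w \<in> cent ball_c0 F" unfolding mem_cent_iff[OF F] R_def by blast
  moreover have "norm (v - w) \<le> d"
    unfolding norm_diff_le_iff_linfty w
  proof
    fix n
    \<comment> \<open>By \<open>bounds\<close> at radius \<open>R + d\<close>, \<open>v n\<close>
      lies in the same interval widened by \<open>d\<close> on each side.\<close>
    show "\<bar>v n - f n\<bar> \<le> d"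
      using bounds[OF rv, of n] si[of n] d unfolding f_def R_def by linarith
  qed
  ultimately show ?thesis by (rule that)
qed

lemma cent_ball_c0_nonempty:
  assumes "F \<in> CB"
  shows "cent ball_c0 F \<noteq> {}"
proof -
  \<comment> \<open>The slack 1 is arbitrary: any near center can be moved to a center.\<close>
  obtain v where "v \<in> ball_c0" "rad_at v F < rad ball_c0 F + 1"
    using rad_nearly_attained[OF ball_c0_nonempty_closed_convex(1), of 1] by auto
  with center_near_near_center[OF assms, of v 1] show ?thesis by force
qed

lemma near_cent_ball_c0_subset:
  assumes "F \<in> CB" "d > 0"
  shows "near_cent ball_c0 F d \<subseteq> enlarge (cent ball_c0 F) d"
proof
  fix v assume "v \<in> near_cent ball_c0 F d"
  then obtain w where "w \<in> cent ball_c0 F" "norm (v - w) \<le> d"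
    using center_near_near_center[OF assms(1), of v d] assms(2) unfolding near_cent_def by auto
  with assms(2) show "v \<in> enlarge (cent ball_c0 F) d" by (intro mem_enlargeI)
qed

theorem corollary2p7:
  shows "property_P1 ball_c0 (CB :: linfty set set) \<and>
    uniformly_hausdorff_continuous (cent ball_c0)"
proof
  show "property_P1 ball_c0 (CB :: linfty set set)"
    unfolding property_P1_def restricted_center_property_def
    using cent_ball_c0_nonempty near_cent_ball_c0_subset by blast
  show "uniformly_hausdorff_continuous (cent ball_c0)"
    using ball_c0_nonempty_closed_convex(2) cent_ball_c0_nonempty near_cent_ball_c0_subset
    by (rule uniformly_hausdorff_continuous_cent)
qed

end
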